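(* Let $\mathcal{E}$ be a coherent category. Then every (internal) co-category $\mathbf{Q}$ in $\mathcal{E}$ is a co-equivalence relation.
   Context: A coherent category is a category with all finite limits, and with images and (finite) unions of subobjects that are stable under pullback. An (internal) co-category $\mathbf{Q}$ in a category $\mathcal{E}$ is an internal category in $\mathcal{E}^{\mathrm{op}}$. Explicitly, it consists of objects $Q^0, Q^1$ and morphisms $l, r : Q^0 \to Q^1$, $i : Q^1 \to Q^0$ and $q : Q^1 \to Q^1 +_{Q^0} Q^1$. Here $Q^1 +_{Q^0} Q^1$ is the pushout of $r$ and $l$, with coprojections $\nu_1, \nu_2 : Q^1 \to Q^1 +_{Q^0} Q^1$ satisfying $\nu_1 r = \nu_2 l$. Similarly, $Q^1 +_{Q^0} Q^1 +_{Q^0} Q^1$ is the colimit gluing three copies of $Q^1$ end to end, with coprojections $\nu_1, \nu_2, \nu_3$ satisfying $\nu_1 r = \nu_2 l$ and $\nu_2 r = \nu_3 l$. The existence of these pushouts is part of the data of a co-category; $\mathcal{E}$ is not assumed to have all pushouts. Square brackets denote maps out of a pushout induced by maps on the components. The following equations are required: - $q l = \nu_1 l$ and $q r = \nu_2 r$; - $i l = 1_{Q^0}$ and $i r = 1_{Q^0}$; - (co-unit) $[l i, 1_{Q^1}]\, q = 1_{Q^1}$ and $[1_{Q^1}, r i]\, q = 1_{Q^1}$; - (co-associativity) $[[\nu_1,\nu_2] q, \nu_3]\, q = [\nu_1, [\nu_2,\nu_3] q]\, q : Q^1 \to Q^1 +_{Q^0} Q^1 +_{Q^0} Q^1$. A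 co-category $\mathbf{Q}$ is a co-preorder if $l, r$ are jointly epimorphic. It is a co-groupoid if there is a map $s : Q^1 \to Q^1$ satisfying the duals of the usual identities for the inverse map of a groupoid, i.e. $s l = r$, $s r = l$, $[1_{Q^1}, s]\, q = l i$ and $[s, 1_{Q^1}]\, q = r i$. It is a co-equivalence relation if it is both a co-groupoid and a co-preorder. *)

theory Defs
  imports Main
begin

section \<open>Categories\<close>

text \<open>Composition is written in the usual order: in \<open>g \<cdot> f\<close>, the arrow \<open>f\<close> is applied first.\<close>

record ('o, 'a) cat =
  Obj :: "'o set"
  Arr :: "'a set"
  Dom :: "'a \<Rightarrow> 'o"
  Cod :: "'a \<Rightarrow> 'o"
  Idn :: "'o \<Rightarrow> 'a"
  Cmp :: "'a \<Rightarrow> 'a \<Rightarrow> 'a" (infixr "\<cdot>\<index>" 70)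

definition hom :: "('o, 'a) cat \<Rightarrow> 'o \<Rightarrow> 'o \<Rightarrow> 'a set" where
  "hom C X Y = {f \<in> Arr C. Dom C f = X \<and> Cod C f = Y}"

locale category =
  fixes C :: "('o, 'a) cat" (structure)
  assumes dom_in_obj: "f \<in> Arr C \<Longrightarrow> Dom C f \<in> Obj C"
    and cod_in_obj: "f \<in> Arr C \<Longrightarrow> Cod C f \<in> Obj C"
    and idn_in_hom: "X \<in> Obj C \<Longrightarrow> Idn C X \<in> hom C X X"
    and cmp_in_hom: "f \<in> hom C X Y \<Longrightarrow> g \<in> hom C Y Z \<Longrightarrow> g \<cdot> f \<in> hom C X Z"
    and cmp_idn_left: "f \<in> hom C X Y \<Longrightarrow> Idn C Y \<cdot> f = f"
    and cmp_idn_right: "f \<in> hom C X Y \<Longrightarrow> f \<cdot> Idn C X = f"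
    and cmp_assoc: "f \<in> hom C W X \<Longrightarrow> g \<in> hom C X Y \<Longrightarrow> h \<in> hom C Y Z \<Longrightarrow>
      (h \<cdot> g) \<cdot> f = h \<cdot> (g \<cdot> f)"

locale cat_functor = J: category J + C: category C
  for J :: "('j, 'b) cat" and C :: "('o, 'a) cat" +
  fixes Fo :: "'j \<Rightarrow> 'o" and Fa :: "'b \<Rightarrow> 'a"
  assumes map_obj: "j \<in> Obj J \<Longrightarrow> Fo j \<in> Obj C"
    and map_arr: "u \<in> hom J j k \<Longrightarrow> Fa u \<in> hom C (Fo j) (Fo k)"
    and map_idn: "j \<in> Obj J \<Longrightarrow> Fa (Idn J j) = Idn C (Fo j)"
    and map_cmp: "u \<in> hom J j k \<Longrightarrow> v \<in> hom J k l \<Longrightarrow>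
      Fa (v \<cdot>\<^bsub>J\<^esub> u) = Fa v \<cdot>\<^bsub>C\<^esub> Fa u"


section \<open>Finite limits\<close>

definition is_cone ::
  "('j, 'b) cat \<Rightarrow> ('o, 'a) cat \<Rightarrow> ('j \<Rightarrow> 'o) \<Rightarrow> ('b \<Rightarrow> 'a) \<Rightarrow> 'o \<Rightarrow> ('j \<Rightarrow> 'a) \<Rightarrow> bool" where
  "is_cone J C Fo Fa X p \<longleftrightarrow>
     X \<in> Obj C \<and>
     (\<forall>j \<in> Obj J. p j \<in> hom C X (Fo j)) \<and>
     (\<forall>u \<in> Arr J. Fa u \<cdot>\<^bsub>C\<^esub> p (Dom J u) = p (Cod J u))"

definition is_limit ::
  "('j, 'b) cat \<Rightarrow> ('o, 'a) cat \<Rightarrow> ('j \<Rightarrow> 'o) \<Rightarrow> ('b \<Rightarrow> 'a) \<Rightarrow> 'o \<Rightarrow> ('j \<Rightarrow> 'a) \<Rightarrow> bool" where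
  "is_limit J C Fo Fa X p \<longleftrightarrow>
     is_cone J C Fo Fa X p \<and>
     (\<forall>Y t. is_cone J C Fo Fa Y t \<longrightarrow>
        (\<exists>!h. h \<in> hom C Y X \<and> (\<forall>j \<in> Obj J. p j \<cdot>\<^bsub>C\<^esub> h = t j)))"

text \<open>
  Every finite category is isomorphic to one whose objects and arrows are natural numbers,
  so restricting the type of the index category loses no finite diagram shape.
\<close>

definition has_finite_limits :: "('o, 'a) cat \<Rightarrow> bool" where
  "has_finite_limits C \<longleftrightarrow>
     (\<forall>(J :: (nat, nat) cat) Fo Fa.
        finite (Obj J) \<and> finite (Arr J) \<and> cat_functor J C Fo Fa \<longrightarrow>
        (\<exists>X p. is_limit J C Fo Fa X p))"


section \<open>Pullbacks and subobjects\<close>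

text \<open>
  \<open>is_pullback C f g p f'\<close>: in the square \<open>f \<cdot> p = g \<cdot> f'\<close>, the arrow \<open>f'\<close> is a pullback of
  \<open>f\<close> along \<open>g\<close>.
\<close>

definition is_pullback :: "('o, 'a) cat \<Rightarrow> 'a \<Rightarrow> 'a \<Rightarrow> 'a \<Rightarrow> 'a \<Rightarrow> bool" where
  "is_pullback C f g p f' \<longleftrightarrow>
     f \<in> Arr C \<and> g \<in> Arr C \<and> Cod C f = Cod C g \<and>
     p \<in> hom C (Dom C f') (Dom C f) \<and> f' \<in> hom C (Dom C f') (Dom C g) \<and>
     f \<cdot>\<^bsub>C\<^esub> p = g \<cdot>\<^bsub>C\<^esub> f' \<and>
     (\<forall>Y. \<forall>a \<in> hom C Y (Dom C f). \<forall>b \<in> hom C Y (Dom C g).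
        f \<cdot>\<^bsub>C\<^esub> a = g \<cdot>\<^bsub>C\<^esub> b \<longrightarrow>
        (\<exists>!h. h \<in> hom C Y (Dom C f') \<and> p \<cdot>\<^bsub>C\<^esub> h = a \<and> f' \<cdot>\<^bsub>C\<^esub> h = b))"

definition pullback_along :: "('o, 'a) cat \<Rightarrow> 'a \<Rightarrow> 'a \<Rightarrow> 'a \<Rightarrow> bool" where
  "pullback_along C g f f' \<longleftrightarrow> (\<exists>p. is_pullback C f g p f')"

definition monic :: "('o, 'a) cat \<Rightarrow> 'a \<Rightarrow> bool" where
  "monic C m \<longleftrightarrow>
     m \<in> Arr C \<and>
     (\<forall>Y. \<forall>f \<in> hom C Y (Dom C m). \<forall>g \<in> hom C Y (Dom C m).
        m \<cdot>\<^bsub>C\<^esub> f = m \<cdot>\<^bsub>C\<^esub> g \<longrightarrow> f = g)"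

text \<open>
  A subobject of \<open>X\<close> is represented by a monomorphism into \<open>X\<close>. The inclusion preorder on
  these representatives is factorisation, so images and unions are determined up to isomorphism.
\<close>

definition subobj :: "('o, 'a) cat \<Rightarrow> 'o \<Rightarrow> 'a set" where
  "subobj C X = {m. monic C m \<and> Cod C m = X}"

definition factors_through :: "('o, 'a) cat \<Rightarrow> 'a \<Rightarrow> 'a \<Rightarrow> bool" where
  "factors_through C f m \<longleftrightarrow> (\<exists>h \<in> hom C (Dom C f) (Dom C m). f = m \<cdot>\<^bsub>C\<^esub> h)"

definition is_image :: "('o, 'a) cat \<Rightarrow> 'a \<Rightarrow> 'a \<Rightarrow> bool" where
  "is_image C f m \<longleftrightarrow>
     m \<in> subobj C (Cod C f) \<and> factors_through C f m \<and>
     (\<forall>n \<in> subobj C (Cod C f). factors_through C f n \<longrightarrow> factors_through C m n)"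

definition is_union :: "('o, 'a) cat \<Rightarrow> 'o \<Rightarrow> 'a set \<Rightarrow> 'a \<Rightarrow> bool" where
  "is_union C X S u \<longleftrightarrow>
     u \<in> subobj C X \<and> (\<forall>m \<in> S. factors_through C m u) \<and>
     (\<forall>n \<in> subobj C X. (\<forall>m \<in> S. factors_through C m n) \<longrightarrow> factors_through C u n)"


section \<open>Coherent categories\<close>

text \<open>
  Finite unions include the empty one, i.e. the least subobject of each object.
  In \<open>union_stable\<close>, the function \<open>t\<close> chooses a pullback of each member of the family.
\<close>

locale coherent_category = category C
  for C :: "('o, 'a) cat" (structure) +
  assumes finite_limits: "has_finite_limits C"
    and images: "f \<in> Arr C \<Longrightarrow> \<exists>m. is_image C f m"
    and image_stable:
      "f \<in> Arr C \<Longrightarrow> is_image C f m \<Longrightarrow> g \<in> Arr C \<Longrightarrow> Cod C g = Cod C f \<Longrightarrow>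
       pullback_along C g f f' \<Longrightarrow> pullback_along C g m m' \<Longrightarrow> is_image C f' m'"
    and unions:
      "X \<in> Obj C \<Longrightarrow> finite S \<Longrightarrow> S \<subseteq> subobj C X \<Longrightarrow> \<exists>u. is_union C X S u"
    and union_stable:
      "X \<in> Obj C \<Longrightarrow> finite S \<Longrightarrow> S \<subseteq> subobj C X \<Longrightarrow> is_union C X S u \<Longrightarrow> g \<in> hom C Y X \<Longrightarrow>
       (\<And>m. m \<in> S \<Longrightarrow> pullback_along C g m (t m)) \<Longrightarrow> pullback_along C g u u' \<Longrightarrow>
       is_union C Y (t ` S) u'"


section \<open>Internal co-categories\<close>

text \<open>
  The chosen pushouts belong to the structure: \<open>Q2\<close> with \<open>nu1\<close>, \<open>nu2\<close> is the pushout
  $Q^1 +_{Q^0} Q^1$, and \<open>Q3\<close> with \<open>ka1\<close>, \<open>ka2\<close>, \<open>ka3\<close> is $Q^1 +_{Q^0} Q^1 +_{Q^0} Q^1$.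
\<close>

record ('o, 'a) cocat =
  Q0 :: 'o
  Q1 :: 'o
  Q2 :: 'o
  Q3 :: 'o
  lft :: 'a
  rgt :: 'a
  cid :: 'a
  cocomp :: 'a
  nu1 :: 'a
  nu2 :: 'a
  ka1 :: 'a
  ka2 :: 'a
  ka3 :: 'a

definition is_pushout2 :: "('o, 'a) cat \<Rightarrow> ('o, 'a) cocat \<Rightarrow> bool" where
  "is_pushout2 C Q \<longleftrightarrow>
     nu1 Q \<in> hom C (Q1 Q) (Q2 Q) \<and> nu2 Q \<in> hom C (Q1 Q) (Q2 Q) \<and>
     nu1 Q \<cdot>\<^bsub>C\<^esub> rgt Q = nu2 Q \<cdot>\<^bsub>C\<^esub> lft Q \<and>
     (\<forall>Z. \<forall>a \<in> hom C (Q1 Q) Z. \<forall>b \<in> hom C (Q1 Q) Z.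
        a \<cdot>\<^bsub>C\<^esub> rgt Q = b \<cdot>\<^bsub>C\<^esub> lft Q \<longrightarrow>
        (\<exists>!h. h \<in> hom C (Q2 Q) Z \<and> h \<cdot>\<^bsub>C\<^esub> nu1 Q = a \<and> h \<cdot>\<^bsub>C\<^esub> nu2 Q = b))"

definition is_pushout3 :: "('o, 'a) cat \<Rightarrow> ('o, 'a) cocat \<Rightarrow> bool" where
  "is_pushout3 C Q \<longleftrightarrow>
     ka1 Q \<in> hom C (Q1 Q) (Q3 Q) \<and> ka2 Q \<in> hom C (Q1 Q) (Q3 Q) \<and>
     ka3 Q \<in> hom C (Q1 Q) (Q3 Q) \<and>
     ka1 Q \<cdot>\<^bsub>C\<^esub> rgt Q = ka2 Q \<cdot>\<^bsub>C\<^esub> lft Q \<and>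
     ka2 Q \<cdot>\<^bsub>C\<^esub> rgt Q = ka3 Q \<cdot>\<^bsub>C\<^esub> lft Q \<and>
     (\<forall>Z. \<forall>a \<in> hom C (Q1 Q) Z. \<forall>b \<in> hom C (Q1 Q) Z. \<forall>c \<in> hom C (Q1 Q) Z.
        a \<cdot>\<^bsub>C\<^esub> rgt Q = b \<cdot>\<^bsub>C\<^esub> lft Q \<and> b \<cdot>\<^bsub>C\<^esub> rgt Q = c \<cdot>\<^bsub>C\<^esub> lft Q \<longrightarrow>
        (\<exists>!h. h \<in> hom C (Q3 Q) Z \<and>
           h \<cdot>\<^bsub>C\<^esub> ka1 Q = a \<and> h \<cdot>\<^bsub>C\<^esub> ka2 Q = b \<and> h \<cdot>\<^bsub>C\<^esub> ka3 Q = c))"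

text \<open>
  \<open>copair C Q a b\<close> is the induced map $[a, b]$ out of $Q^1 +_{Q^0} Q^1$. It is meaningful only if
  \<open>a\<close> and \<open>b\<close> have the same codomain and \<open>a \<cdot> rgt Q = b \<cdot> lft Q\<close>; at each use below this
  follows from the preceding equations.
\<close>

definition copair :: "('o, 'a) cat \<Rightarrow> ('o, 'a) cocat \<Rightarrow> 'a \<Rightarrow> 'a \<Rightarrow> 'a" where
  "copair C Q a b =
     (THE h. h \<in> hom C (Q2 Q) (Cod C a) \<and> h \<cdot>\<^bsub>C\<^esub> nu1 Q = a \<and> h \<cdot>\<^bsub>C\<^esub> nu2 Q = b)"

locale co_category = category C
  for C :: "('o, 'a) cat" (structure) +
  fixes Q :: "('o, 'a) cocat"
  assumes Q0_obj: "Q0 Q \<in> Obj C"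
    and Q1_obj: "Q1 Q \<in> Obj C"
    and Q2_obj: "Q2 Q \<in> Obj C"
    and Q3_obj: "Q3 Q \<in> Obj C"
    and lft_hom: "lft Q \<in> hom C (Q0 Q) (Q1 Q)"
    and rgt_hom: "rgt Q \<in> hom C (Q0 Q) (Q1 Q)"
    and cid_hom: "cid Q \<in> hom C (Q1 Q) (Q0 Q)"
    and cocomp_hom: "cocomp Q \<in> hom C (Q1 Q) (Q2 Q)"
    and pushout2: "is_pushout2 C Q"
    and pushout3: "is_pushout3 C Q"
    and cocomp_lft: "cocomp Q \<cdot> lft Q = nu1 Q \<cdot> lft Q"
    and cocomp_rgt: "cocomp Q \<cdot> rgt Q = nu2 Q \<cdot> rgt Q"
    and cid_lft: "cid Q \<cdot> lft Q = Idn C (Q0 Q)"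
    and cid_rgt: "cid Q \<cdot> rgt Q = Idn C (Q0 Q)"
    and counit_lft: "copair C Q (lft Q \<cdot> cid Q) (Idn C (Q1 Q)) \<cdot> cocomp Q = Idn C (Q1 Q)"
    and counit_rgt: "copair C Q (Idn C (Q1 Q)) (rgt Q \<cdot> cid Q) \<cdot> cocomp Q = Idn C (Q1 Q)"
    and coassoc:
      "copair C Q (copair C Q (ka1 Q) (ka2 Q) \<cdot> cocomp Q) (ka3 Q) \<cdot> cocomp Q =
       copair C Q (ka1 Q) (copair C Q (ka2 Q) (ka3 Q) \<cdot> cocomp Q) \<cdot> cocomp Q"

locale co_preorder = co_category C Q
  for C :: "('o, 'a) cat" (structure) and Q :: "('o, 'a) cocat" +
  assumes jointly_epi:
    "f \<in> hom C (Q1 Q) Z \<Longrightarrow> g \<in> hom C (Q1 Q) Z \<Longrightarrow>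
     f \<cdot> lft Q = g \<cdot> lft Q \<Longrightarrow> f \<cdot> rgt Q = g \<cdot> rgt Q \<Longrightarrow> f = g"

locale co_groupoid = co_category C Q
  for C :: "('o, 'a) cat" (structure) and Q :: "('o, 'a) cocat" +
  assumes coinverse:
    "\<exists>s \<in> hom C (Q1 Q) (Q1 Q).
       s \<cdot> lft Q = rgt Q \<and> s \<cdot> rgt Q = lft Q \<and>
       copair C Q (Idn C (Q1 Q)) s \<cdot> cocomp Q = lft Q \<cdot> cid Q \<and>
       copair C Q s (Idn C (Q1 Q)) \<cdot> cocomp Q = rgt Q \<cdot> cid Q"

locale co_equivalence_relation = co_groupoid C Q + co_preorder C Q
  for C :: "('o, 'a) cat" (structure) and Q :: "('o, 'a) cocat"

end

theory Submission
  imports Defs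
begin

text \<open>
  Read in the internal logic, the argument is elementwise. The pushout $Q^1 +_{Q^0} Q^1$ is the
  union of its two coprojections, so for \<open>x\<close> in $Q^1$ either $q x = \nu_1 y$ or $q x = \nu_2 y$.
  In the first case one co-unit law gives $y = x$ and then the other gives $x = l i x$; in the
  second case $x = r i x$. Hence $Q^1$ is the union of $l$ and $r$, which are therefore jointly
  epimorphic. The co-inverse has as its graph the union of $(l, r)$ and $(r, l)$ in
  $Q^1 \times Q^1$. This relation is total because $l$ and $r$ cover, and single-valued because
  $l a = r b$ forces $a = b$ on applying $i$. Its equations hold because they hold on $l$ and $r$.
\<close>

section \<open>Limits of bipartite diagrams\<close>

text \<open>
  The free category on a bipartite graph: the identity of the vertex \<open>j\<close> is \<open>j\<close> itself, so
  vertices and edges must be disjoint, and no two edges are composable.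
\<close>

definition bipartite_cat ::
  "nat set \<Rightarrow> nat set \<Rightarrow> (nat \<Rightarrow> nat) \<Rightarrow> (nat \<Rightarrow> nat) \<Rightarrow> (nat, nat) cat" where
  "bipartite_cat V E d c =
     \<lparr> Obj = V, Arr = V \<union> E,
       Dom = (\<lambda>u. if u \<in> V then u else d u), Cod = (\<lambda>u. if u \<in> V then u else c u),
       Idn = (\<lambda>j. j), Cmp = (\<lambda>v u. if v \<in> V then u else v) \<rparr>"

lemma bipartite_cat_category:
  assumes "V \<inter> E = {}" "d ` E \<subseteq> V" "c ` E \<subseteq> V" "d ` E \<inter> c ` E = {}"
  shows "category (bipartite_cat V E d c)"
  by unfold_locales
    (use assms in \<open>auto simp: bipartite_cat_def hom_def image_subset_iff split: if_splits\<close>)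

context category
begin

lemma hom_objs: "f \<in> hom C X Y \<Longrightarrow> X \<in> Obj C \<and> Y \<in> Obj C"
  using dom_in_obj cod_in_obj by (auto simp: hom_def)

lemma in_homD: "f \<in> hom C X Y \<Longrightarrow> f \<in> Arr C \<and> Dom C f = X \<and> Cod C f = Y"
  by (simp add: hom_def)

lemma bipartite_functor:
  assumes "V \<inter> E = {}" "d ` E \<subseteq> V" "c ` E \<subseteq> V" "d ` E \<inter> c ` E = {}"
    and obj: "\<And>j. j \<in> V \<Longrightarrow> Fo j \<in> Obj C"
    and arr: "\<And>e. e \<in> E \<Longrightarrow> Fa e \<in> hom C (Fo (d e)) (Fo (c e))"
  shows "cat_functor (bipartite_cat V E d c) C Fo (\<lambda>u. if u \<in> V then Idn C (Fo u) else Fa u)"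
proof -
  interpret J: category "bipartite_cat V E d c"
    by (rule bipartite_cat_category) fact+
  show ?thesis
  proof
    fix u j k l v
    let ?F = "\<lambda>u. if u \<in> V then Idn C (Fo u) else Fa u"
    show F: "?F u \<in> hom C (Fo j) (Fo k)" if "u \<in> hom (bipartite_cat V E d c) j k" for u j k
      using that arr idn_in_hom[OF obj]
      by (auto simp: hom_def bipartite_cat_def split: if_splits)
    assume u: "u \<in> hom (bipartite_cat V E d c) j k" and v: "v \<in> hom (bipartite_cat V E d c) k l"
    \<comment> \<open>Of two composable arrows at least one is an identity: if \<open>v\<close> is
      an edge, then \<open>u\<close> cannot be one, since no edge ends where an edge begins.\<close>
    consider "v \<in> V" "v = k" | "v \<in> E" "v \<notin> V" "u = k" "u \<in> V"
      using u v assms(1-4) by (auto simp: hom_def bipartite_cat_def split: if_splits)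
    then show "?F (v \<cdot>\<^bsub>bipartite_cat V E d c\<^esub> u) = ?F v \<cdot> ?F u"
    proof cases
      case 1
      then show ?thesis
        using cmp_idn_left[OF F[OF u]] by (simp add: bipartite_cat_def)
    next
      case 2
      then show ?thesis
        using cmp_idn_right[OF F[OF v]] by (simp add: bipartite_cat_def)
    qed
  qed (use obj in \<open>auto simp: bipartite_cat_def\<close>)
qed

text \<open>Only the edges impose a commutation condition here. At the identities of the free
  category that condition is automatic, so these are the same cones as those of
  \<open>is_cone\<close>.\<close>

definition bipartite_cone ::
  "nat set \<Rightarrow> nat set \<Rightarrow> (nat \<Rightarrow> nat) \<Rightarrow> (nat \<Rightarrow> nat) \<Rightarrow> (nat \<Rightarrow> 'o) \<Rightarrow> (nat \<Rightarrow> 'a) \<Rightarrow>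
   'o \<Rightarrow> (nat \<Rightarrow> 'a) \<Rightarrow> bool" where
  "bipartite_cone V E d c Fo Fa X p \<longleftrightarrow>
     X \<in> Obj C \<and> (\<forall>j\<in>V. p j \<in> hom C X (Fo j)) \<and> (\<forall>e\<in>E. Fa e \<cdot> p (d e) = p (c e))"

definition bipartite_limit ::
  "nat set \<Rightarrow> nat set \<Rightarrow> (nat \<Rightarrow> nat) \<Rightarrow> (nat \<Rightarrow> nat) \<Rightarrow> (nat \<Rightarrow> 'o) \<Rightarrow> (nat \<Rightarrow> 'a) \<Rightarrow>
   'o \<Rightarrow> (nat \<Rightarrow> 'a) \<Rightarrow> bool" where
  "bipartite_limit V E d c Fo Fa X p \<longleftrightarrow>
     bipartite_cone V E d c Fo Fa X p \<and>
     (\<forall>Y t. bipartite_cone V E d c Fo Fa Y t \<longrightarrow>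
        (\<exists>!h. h \<in> hom C Y X \<and> (\<forall>j\<in>V. p j \<cdot> h = t j)))"

lemma bipartite_cone_iff:
  assumes "V \<inter> E = {}"
  shows "is_cone (bipartite_cat V E d c) C Fo (\<lambda>u. if u \<in> V then Idn C (Fo u) else Fa u) X p \<longleftrightarrow>
    bipartite_cone V E d c Fo Fa X p"
proof -
  have "e \<notin> V" if "e \<in> E" for e
    using that assms by auto
  moreover have "Idn C (Fo j) \<cdot> p j = p j" if "\<forall>j\<in>V. p j \<in> hom C X (Fo j)" "j \<in> V" for j
    using that cmp_idn_left by blast
  ultimately show ?thesis
    unfolding is_cone_def bipartite_cone_def by (simp add: bipartite_cat_def ball_Un cong: conj_cong)
qed

lemma exists_bipartite_limit:
  assumes lims: "has_finite_limits C" and fin: "finite V" "finite E"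
    and graph: "V \<inter> E = {}" "d ` E \<subseteq> V" "c ` E \<subseteq> V" "d ` E \<inter> c ` E = {}"
    and diag: "\<And>j. j \<in> V \<Longrightarrow> Fo j \<in> Obj C"
      "\<And>e. e \<in> E \<Longrightarrow> Fa e \<in> hom C (Fo (d e)) (Fo (c e))"
  shows "\<exists>X p. bipartite_limit V E d c Fo Fa X p"
proof -
  let ?J = "bipartite_cat V E d c"
  have J: "Obj ?J = V" "Arr ?J = V \<union> E"
    by (simp_all add: bipartite_cat_def)
  have "cat_functor ?J C Fo (\<lambda>u. if u \<in> V then Idn C (Fo u) else Fa u)"
    by (rule bipartite_functor) fact+
  then have "\<exists>X p. is_limit ?J C Fo (\<lambda>u. if u \<in> V then Idn C (Fo u) else Fa u) X p"
    using lims fin J unfolding has_finite_limits_def by simp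
  then show ?thesis
    unfolding is_limit_def bipartite_cone_iff[OF graph(1)] J(1) bipartite_limit_def .
qed

section \<open>Products, equalizers and pullbacks\<close>

lemma exists_product:
  assumes lims: "has_finite_limits C" and "A \<in> Obj C" "B \<in> Obj C"
  obtains P p1 p2 where "P \<in> Obj C" "p1 \<in> hom C P A" "p2 \<in> hom C P B"
    "\<forall>Y. \<forall>a \<in> hom C Y A. \<forall>b \<in> hom C Y B. \<exists>!h. h \<in> hom C Y P \<and> p1 \<cdot> h = a \<and> p2 \<cdot> h = b"
proof -
  let ?Fo = "\<lambda>j :: nat. if j = 0 then A else B"
  \<comment> \<open>A discrete diagram on two vertices: \<open>id\<close>, \<open>id\<close> and
    \<open>undefined\<close> are arbitrary defaults on the empty edge set.\<close>
  have "\<exists>X p. bipartite_limit {0, 1} {} id id ?Fo (\<lambda>_. undefined) X p"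
    by (rule exists_bipartite_limit[OF lims]) (use assms in auto)
  then obtain X p where L: "bipartite_limit {0, 1} {} id id ?Fo (\<lambda>_. undefined) X p"
    by blast
  then have X: "X \<in> Obj C" "p 0 \<in> hom C X A" "p 1 \<in> hom C X B"
    by (simp_all add: bipartite_limit_def bipartite_cone_def)
  have univ: "\<exists>!h. h \<in> hom C Y X \<and> p 0 \<cdot> h = t 0 \<and> p 1 \<cdot> h = t 1"
    if "Y \<in> Obj C" "t 0 \<in> hom C Y A" "t 1 \<in> hom C Y B" for Y and t :: "nat \<Rightarrow> 'a"
    using L[unfolded bipartite_limit_def, THEN conjunct2, rule_format, of Y t] that
    by (simp add: bipartite_cone_def)
  show thesis
  proof (rule that[OF X], intro allI ballI)
    fix Y a b assume ab: "a \<in> hom C Y A" "b \<in> hom C Y B"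
    show "\<exists>!h. h \<in> hom C Y X \<and> p 0 \<cdot> h = a \<and> p 1 \<cdot> h = b"
      using univ[of Y "\<lambda>j. if j = 0 then a else b"] ab hom_objs[OF ab(1)] by simp
  qed
qed

text \<open>Uniqueness of factorisations is packed into \<open>m\<close> being a subobject, so mere
  factorisation suffices in the conclusion.\<close>

lemma exists_equalizer:
  assumes lims: "has_finite_limits C" and f: "f \<in> hom C A B" and g: "g \<in> hom C A B"
  obtains m where "m \<in> subobj C A" "f \<cdot> m = g \<cdot> m"
    "\<And>Y k. k \<in> hom C Y A \<Longrightarrow> f \<cdot> k = g \<cdot> k \<Longrightarrow> factors_through C k m"
proof -
  let ?Fo = "\<lambda>j :: nat. if j = 0 then A else B" and ?Fa = "\<lambda>e :: nat. if e = 2 then f else g"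
  \<comment> \<open>Vertices 0 and 1 carry \<open>A\<close> and \<open>B\<close>; the parallel pair
    gets the labels 2 and 3 to keep edges apart from vertices.\<close>
  have "\<exists>X p. bipartite_limit {0, 1} {2, 3} (\<lambda>_. 0) (\<lambda>_. 1) ?Fo ?Fa X p"
    by (rule exists_bipartite_limit[OF lims]) (use hom_objs[OF f] f g in auto)
  then obtain X p where L: "bipartite_limit {0, 1} {2, 3} (\<lambda>_. 0) (\<lambda>_. 1) ?Fo ?Fa X p"
    by blast
  then have m: "p 0 \<in> hom C X A" and fm: "f \<cdot> p 0 = p 1" and gm: "g \<cdot> p 0 = p 1"
    by (simp_all add: bipartite_limit_def bipartite_cone_def)
  have univ: "\<exists>!h. h \<in> hom C Y X \<and> p 0 \<cdot> h = t 0 \<and> p 1 \<cdot> h = t 1"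
    if "Y \<in> Obj C" "t 0 \<in> hom C Y A" "t 1 \<in> hom C Y B" "f \<cdot> t 0 = t 1" "g \<cdot> t 0 = t 1" for Y and t :: "nat \<Rightarrow> 'a"
    using L[unfolded bipartite_limit_def, THEN conjunct2, rule_format, of Y t] that
    by (simp add: bipartite_cone_def)
  have fac: "\<exists>!h. h \<in> hom C Y X \<and> p 0 \<cdot> h = k" if k: "k \<in> hom C Y A" "f \<cdot> k = g \<cdot> k" for Y k
  proof -
    have "\<exists>!h. h \<in> hom C Y X \<and> p 0 \<cdot> h = k \<and> p 1 \<cdot> h = f \<cdot> k"
      using univ[of Y "\<lambda>j. if j = 0 then k else f \<cdot> k"] k hom_objs[OF k(1)] cmp_in_hom[OF k(1) f]
      by simp
    moreover have "p 1 \<cdot> h = f \<cdot> (p 0 \<cdot> h)" if "h \<in> hom C Y X" for h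
      using cmp_assoc[OF that m f] fm by simp
    ultimately show ?thesis
      by metis
  qed
  show thesis
  proof (rule that[of "p 0"])
    show "f \<cdot> p 0 = g \<cdot> p 0"
      using fm gm by simp
    have "a = b" if ab: "a \<in> hom C Y X" "b \<in> hom C Y X" "p 0 \<cdot> a = p 0 \<cdot> b" for Y a b
    proof -
      have "f \<cdot> p 0 \<cdot> a = g \<cdot> p 0 \<cdot> a"
        using cmp_assoc[OF ab(1) m f] cmp_assoc[OF ab(1) m g] fm gm by simp
      then show ?thesis
        using fac[OF cmp_in_hom[OF ab(1) m]] ab by metis
    qed
    then show "p 0 \<in> subobj C A"
      using in_homD[OF m] by (auto simp: subobj_def monic_def)
    show "factors_through C k (p 0)" if "k \<in> hom C Y A" "f \<cdot> k = g \<cdot> k" for Y k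
      using fac[OF that] in_homD[OF m] in_homD[OF that(1)] unfolding factors_through_def by metis
  qed
qed

lemma exists_pullback:
  assumes lims: "has_finite_limits C" and f: "f \<in> hom C A B" and g: "g \<in> hom C D B"
  shows "\<exists>f'. pullback_along C g f f'"
proof -
  let ?Fo = "\<lambda>j :: nat. if j = 0 then A else if j = 1 then D else B"
    and ?Fa = "\<lambda>e :: nat. if e = 3 then f else g"
    and ?d = "\<lambda>e :: nat. if e = 3 then 0 else 1 :: nat"
  \<comment> \<open>The cospan: edge 3 runs from 0 to 2 and carries \<open>f\<close>, edge 4 runs
    from 1 to 2 and carries \<open>g\<close>.\<close>
  have "\<exists>X p. bipartite_limit {0, 1, 2} {3, 4} ?d (\<lambda>_. 2) ?Fo ?Fa X p"
    by (rule exists_bipartite_limit[OF lims]) (use hom_objs[OF f] hom_objs[OF g] f g in auto)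
  then obtain X p where L: "bipartite_limit {0, 1, 2} {3, 4} ?d (\<lambda>_. 2) ?Fo ?Fa X p"
    by blast
  then have p: "p 0 \<in> hom C X A" "p 1 \<in> hom C X D" "f \<cdot> p 0 = p 2" "g \<cdot> p 1 = p 2"
    by (simp_all add: bipartite_limit_def bipartite_cone_def)
  have univ: "\<exists>!h. h \<in> hom C Y X \<and> p 0 \<cdot> h = t 0 \<and> p 1 \<cdot> h = t 1 \<and> p 2 \<cdot> h = t 2"
    if "Y \<in> Obj C" "t 0 \<in> hom C Y A" "t 1 \<in> hom C Y D" "t 2 \<in> hom C Y B"
      "f \<cdot> t 0 = t 2" "g \<cdot> t 1 = t 2" for Y and t :: "nat \<Rightarrow> 'a"
    using L[unfolded bipartite_limit_def, THEN conjunct2, rule_format, of Y t] that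
    by (simp add: bipartite_cone_def)
  have "\<exists>!h. h \<in> hom C Y X \<and> p 0 \<cdot> h = a \<and> p 1 \<cdot> h = b"
    if ab: "a \<in> hom C Y A" "b \<in> hom C Y D" "f \<cdot> a = g \<cdot> b" for Y a b
  proof -
    have "\<exists>!h. h \<in> hom C Y X \<and> p 0 \<cdot> h = a \<and> p 1 \<cdot> h = b \<and> p 2 \<cdot> h = f \<cdot> a"
      using univ[of Y "\<lambda>j. if j = 0 then a else if j = 1 then b else f \<cdot> a"] ab
        hom_objs[OF ab(1)] cmp_in_hom[OF ab(1) f] by simp
    moreover have "p 2 \<cdot> h = f \<cdot> (p 0 \<cdot> h)" if "h \<in> hom C Y X" for h
      using cmp_assoc[OF that p(1) f] p(3) by simp
    ultimately show ?thesis
      by metis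
  qed
  then have "is_pullback C f g (p 0) (p 1)"
    unfolding is_pullback_def using in_homD[OF f] in_homD[OF g] in_homD[OF p(2)] p by simp
  then show ?thesis
    by (auto simp: pullback_along_def)
qed

section \<open>Split morphisms, subobjects and factorisation\<close>

lemma split_mono_subobj:
  assumes m: "m \<in> hom C X Y" and e: "e \<in> hom C Y X" and "e \<cdot> m = Idn C X"
  shows "m \<in> subobj C Y"
proof -
  have "f = g" if "f \<in> hom C Z X" "g \<in> hom C Z X" "m \<cdot> f = m \<cdot> g" for Z f g
    using that assms(3) cmp_assoc[OF that(1) m e] cmp_assoc[OF that(2) m e]
      cmp_idn_left[OF that(1)] cmp_idn_left[OF that(2)] by simp
  then show ?thesis
    using in_homD[OF m] by (auto simp: subobj_def monic_def)
qed

lemma subobj_hom: "m \<in> subobj C X \<Longrightarrow> m \<in> hom C (Dom C m) X"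
  by (auto simp: subobj_def monic_def hom_def)

lemma subobj_cancel:
  assumes "m \<in> subobj C X" "f \<in> hom C Y (Dom C m)" "g \<in> hom C Y (Dom C m)" "m \<cdot> f = m \<cdot> g"
  shows "f = g"
  using assms by (auto simp: subobj_def monic_def)

lemma split_epi_cancel:
  assumes e: "e \<in> hom C X Y" and h: "h \<in> hom C Y X" "e \<cdot> h = Idn C Y"
    and f: "f \<in> hom C Y Z" and g: "g \<in> hom C Y Z" and eq: "f \<cdot> e = g \<cdot> e"
  shows "f = g"
proof -
  have "f = (f \<cdot> e) \<cdot> h"
    by (simp add: cmp_assoc[OF h(1) e f] h(2) cmp_idn_right[OF f])
  also have "\<dots> = g"
    unfolding eq by (simp add: cmp_assoc[OF h(1) e g] h(2) cmp_idn_right[OF g])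
  finally show ?thesis .
qed

lemma factors_throughI:
  assumes "h \<in> hom C Y Z" "m \<in> hom C Z X" "f = m \<cdot> h"
  shows "factors_through C f m"
  using assms in_homD[OF assms(1)] in_homD[OF assms(2)] in_homD[OF cmp_in_hom[OF assms(1,2)]]
  by (auto simp: factors_through_def)

lemma factors_throughE:
  assumes "factors_through C f m" "f \<in> hom C Y X"
  obtains h where "h \<in> hom C Y (Dom C m)" "f = m \<cdot> h"
  using assms in_homD[OF assms(2)] by (auto simp: factors_through_def)

end

section \<open>Case distinction along a union\<close>

context coherent_category
begin

text \<open>Disjunction elimination for generalised elements \<open>k\<close> of \<open>Y\<close>.
  By stability, the pullback of \<open>u\<close> along \<open>w\<close> is the union of the
  pullbacks of the members of \<open>S\<close>. Each of these lies in \<open>n\<close> by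
  \<open>cases\<close>, hence so does their union. It has a section because \<open>w\<close> factors
  through \<open>u\<close>, so \<open>n\<close> has one too, which says that \<open>n\<close> is all
  of \<open>Y\<close>.\<close>

lemma union_cases_subobj:
  assumes S: "finite S" "S \<subseteq> subobj C X" and u: "is_union C X S u"
    and w: "w \<in> hom C Y X" "factors_through C w u" and n: "n \<in> subobj C Y"
    and cases: "\<And>K k m. k \<in> hom C K Y \<Longrightarrow> m \<in> S \<Longrightarrow> factors_through C (w \<cdot> k) m \<Longrightarrow>
      factors_through C k n"
  obtains h where "h \<in> hom C Y (Dom C n)" "n \<cdot> h = Idn C Y"
proof -
  have "\<forall>m\<in>S. \<exists>f'. pullback_along C w m f'"
    using exists_pullback[OF finite_limits subobj_hom w(1)] S(2) by blast
  then obtain t where t: "\<And>m. m \<in> S \<Longrightarrow> pullback_along C w m (t m)"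
    by metis
  have uX: "u \<in> hom C (Dom C u) X"
    using u subobj_hom by (auto simp: is_union_def)
  then obtain u' p where pb: "is_pullback C u w p u'"
    using exists_pullback[OF finite_limits uX w(1)] by (auto simp: pullback_along_def)
  have Y: "Y \<in> Obj C" "X \<in> Obj C"
    using hom_objs[OF w(1)] by auto
  have un: "is_union C Y (t ` S) u'"
    using union_stable[OF Y(2) S u w(1) t] pb by (auto simp: pullback_along_def)
  have "factors_through C (t m) n" if m: "m \<in> S" for m
  proof -
    obtain q where q: "is_pullback C m w q (t m)"
      using t[OF m] by (auto simp: pullback_along_def)
    \<comment> \<open>The pulled-back member \<open>t m\<close> itself serves as the generalised
      element in \<open>cases\<close>.\<close>
    have "t m \<in> hom C (Dom C (t m)) Y" "q \<in> hom C (Dom C (t m)) (Dom C m)" "w \<cdot> t m = m \<cdot> q"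
      using q in_homD[OF w(1)] by (auto simp: is_pullback_def)
    then show ?thesis
      using cases m S(2) subobj_hom factors_throughI by blast
  qed
  then have "factors_through C u' n"
    using un n by (auto simp: is_union_def)
  moreover have u'Y: "u' \<in> hom C (Dom C u') Y"
    using un subobj_hom by (auto simp: is_union_def)
  ultimately obtain z where z: "z \<in> hom C (Dom C u') (Dom C n)" "u' = n \<cdot> z"
    using factors_throughE by blast
  obtain h where h: "h \<in> hom C Y (Dom C u)" "w = u \<cdot> h"
    using w factors_throughE by blast
  \<comment> \<open>The pair of \<open>h\<close> and the identity is a cone over the pullback
    square; the induced map is a section of \<open>u'\<close>.\<close>
  have "u \<cdot> h = w \<cdot> Idn C Y"
    using h cmp_idn_right[OF w(1)] by simp
  then obtain v where v: "v \<in> hom C Y (Dom C u')" "u' \<cdot> v = Idn C Y"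
    using pb h(1) idn_in_hom[OF Y(1)] in_homD[OF w(1)] unfolding is_pullback_def by metis
  show thesis
    using that[OF cmp_in_hom[OF v(1) z(1)]] cmp_assoc[OF v(1) z(1) subobj_hom[OF n]] v z by simp
qed

text \<open>Disjunction elimination for an equation, obtained by taking the equalizer of
  \<open>f\<close> and \<open>g\<close> as the subobject.\<close>

lemma union_cases_eq:
  assumes S: "finite S" "S \<subseteq> subobj C X" and u: "is_union C X S u"
    and w: "w \<in> hom C Y X" "factors_through C w u"
    and fg: "f \<in> hom C Y Z" "g \<in> hom C Y Z"
    and cases: "\<And>K k m. k \<in> hom C K Y \<Longrightarrow> m \<in> S \<Longrightarrow> factors_through C (w \<cdot> k) m \<Longrightarrow>
      f \<cdot> k = g \<cdot> k"
  shows "f = g"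
proof -
  obtain e where e: "e \<in> subobj C Y" "f \<cdot> e = g \<cdot> e"
    "\<And>K k. k \<in> hom C K Y \<Longrightarrow> f \<cdot> k = g \<cdot> k \<Longrightarrow> factors_through C k e"
    using exists_equalizer[OF finite_limits fg] by metis
  obtain h where h: "h \<in> hom C Y (Dom C e)" "e \<cdot> h = Idn C Y"
    using union_cases_subobj[OF S u w e(1)] e(3) cases by metis
  show ?thesis
    by (rule split_epi_cancel[OF subobj_hom[OF e(1)] h fg e(2)])
qed

end

section \<open>Co-categories\<close>

context co_category
begin

lemma nu_hom: "nu1 Q \<in> hom C (Q1 Q) (Q2 Q)" "nu2 Q \<in> hom C (Q1 Q) (Q2 Q)"
  and nu_glue: "nu1 Q \<cdot> rgt Q = nu2 Q \<cdot> lft Q"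
  using pushout2 by (auto simp: is_pushout2_def)

lemma pushout_univ:
  assumes "a \<in> hom C (Q1 Q) Z" "b \<in> hom C (Q1 Q) Z" "a \<cdot> rgt Q = b \<cdot> lft Q"
  shows "\<exists>!h. h \<in> hom C (Q2 Q) Z \<and> h \<cdot> nu1 Q = a \<and> h \<cdot> nu2 Q = b"
  using pushout2 assms by (auto simp: is_pushout2_def)

lemma copair:
  assumes "a \<in> hom C (Q1 Q) Z" "b \<in> hom C (Q1 Q) Z" "a \<cdot> rgt Q = b \<cdot> lft Q"
  shows "copair C Q a b \<in> hom C (Q2 Q) Z"
    and "copair C Q a b \<cdot> nu1 Q = a" and "copair C Q a b \<cdot> nu2 Q = b"
  using theI'[OF pushout_univ[OF assms]] in_homD[OF assms(1)] by (auto simp: copair_def)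

lemmas idn_Q1 = idn_in_hom[OF Q1_obj]

lemma cid_lft_cmp: "a \<in> hom C Y (Q0 Q) \<Longrightarrow> cid Q \<cdot> lft Q \<cdot> a = a"
  and cid_rgt_cmp: "a \<in> hom C Y (Q0 Q) \<Longrightarrow> cid Q \<cdot> rgt Q \<cdot> a = a"
  using cmp_assoc[OF _ lft_hom cid_hom] cmp_assoc[OF _ rgt_hom cid_hom] cmp_idn_left
  by (auto simp: cid_lft cid_rgt)

text \<open>These are the gluing conditions that make \<open>[l i, 1]\<close> and
  \<open>[1, r i]\<close>, the copairings of the co-unit laws, meaningful; they reduce to
  \<open>i r = 1\<close> and \<open>i l = 1\<close>.\<close>

lemma degenerate_glue:
  "lft Q \<cdot> cid Q \<in> hom C (Q1 Q) (Q1 Q)" "rgt Q \<cdot> cid Q \<in> hom C (Q1 Q) (Q1 Q)"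
  "(lft Q \<cdot> cid Q) \<cdot> rgt Q = Idn C (Q1 Q) \<cdot> lft Q"
  "Idn C (Q1 Q) \<cdot> rgt Q = (rgt Q \<cdot> cid Q) \<cdot> lft Q"
  using cmp_in_hom[OF cid_hom lft_hom] cmp_in_hom[OF cid_hom rgt_hom]
    cmp_assoc[OF rgt_hom cid_hom lft_hom] cmp_assoc[OF lft_hom cid_hom rgt_hom]
    cmp_idn_left[OF lft_hom] cmp_idn_left[OF rgt_hom] cmp_idn_right[OF lft_hom]
    cmp_idn_right[OF rgt_hom] by (simp_all add: cid_lft cid_rgt)

lemmas copair_lft = copair[OF degenerate_glue(1) idn_Q1 degenerate_glue(3)]
lemmas copair_rgt = copair[OF idn_Q1 degenerate_glue(2) degenerate_glue(4)]

text \<open>The coprojections are split: \<open>[1, r i]\<close> is a retraction of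
  \<open>nu1 Q\<close>, and \<open>[l i, 1]\<close> is one of \<open>nu2 Q\<close>.\<close>

lemma nu_subobj: "{nu1 Q, nu2 Q} \<subseteq> subobj C (Q2 Q)"
  using split_mono_subobj[OF nu_hom(1) copair_rgt(1,2)]
    split_mono_subobj[OF nu_hom(2) copair_lft(1,3)] by simp

text \<open>The factorisations of the coprojections through the monic \<open>u\<close> still agree
  on the glued endpoint, so the pushout property yields a section of \<open>u\<close>. Everything
  into \<open>Q2 Q\<close> then factors through \<open>u\<close>, in particular
  \<open>q\<close>.\<close>

lemma nu_union:
  assumes u: "is_union C (Q2 Q) {nu1 Q, nu2 Q} u"
  shows "factors_through C (cocomp Q) u"
proof -
  have su: "u \<in> subobj C (Q2 Q)" and uh: "u \<in> hom C (Dom C u) (Q2 Q)"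
    using u subobj_hom by (auto simp: is_union_def)
  have "factors_through C (nu1 Q) u" "factors_through C (nu2 Q) u"
    using u by (auto simp: is_union_def)
  then obtain a b where a: "a \<in> hom C (Q1 Q) (Dom C u)" "nu1 Q = u \<cdot> a"
    and b: "b \<in> hom C (Q1 Q) (Dom C u)" "nu2 Q = u \<cdot> b"
    using factors_throughE nu_hom by metis
  have "a \<cdot> rgt Q = b \<cdot> lft Q"
    using subobj_cancel[OF su cmp_in_hom[OF rgt_hom a(1)] cmp_in_hom[OF lft_hom b(1)]]
      cmp_assoc[OF rgt_hom a(1) uh] cmp_assoc[OF lft_hom b(1) uh] nu_glue a(2) b(2) by simp
  from pushout_univ[OF a(1) b(1) this]
  obtain h where h: "h \<in> hom C (Q2 Q) (Dom C u)" "h \<cdot> nu1 Q = a" "h \<cdot> nu2 Q = b"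
    by blast
  have "u \<cdot> h = Idn C (Q2 Q)"
  proof -
    have "(u \<cdot> h) \<cdot> nu1 Q = nu1 Q" "(u \<cdot> h) \<cdot> nu2 Q = nu2 Q"
      using cmp_assoc[OF nu_hom(1) h(1) uh] cmp_assoc[OF nu_hom(2) h(1) uh] h a b by auto
    then show ?thesis
      using pushout_univ[OF nu_hom nu_glue] cmp_in_hom[OF h(1) uh] idn_in_hom[OF Q2_obj]
        cmp_idn_left[OF nu_hom(1)] cmp_idn_left[OF nu_hom(2)] by blast
  qed
  then have "cocomp Q = u \<cdot> h \<cdot> cocomp Q"
    using cmp_assoc[OF cocomp_hom h(1) uh] cmp_idn_left[OF cocomp_hom] by simp
  then show ?thesis
    by (rule factors_throughI[OF cmp_in_hom[OF cocomp_hom h(1)] uh])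
qed

lemma counit_cmp:
  assumes "k \<in> hom C K (Q1 Q)"
  shows "copair C Q (lft Q \<cdot> cid Q) (Idn C (Q1 Q)) \<cdot> cocomp Q \<cdot> k = k"
    and "copair C Q (Idn C (Q1 Q)) (rgt Q \<cdot> cid Q) \<cdot> cocomp Q \<cdot> k = k"
  using cmp_assoc[OF assms cocomp_hom copair_lft(1)] cmp_assoc[OF assms cocomp_hom copair_rgt(1)]
    cmp_idn_left[OF assms] by (simp_all add: counit_lft counit_rgt)

text \<open>From \<open>q k = nu1 y\<close>, composing with \<open>[1, r i]\<close> gives
  \<open>k = y\<close>, and composing with \<open>[l i, 1]\<close> gives
  \<open>k = l i y\<close>.\<close>

lemma factors_nu1_imp_lft:
  assumes k: "k \<in> hom C K (Q1 Q)" and y: "factors_through C (cocomp Q \<cdot> k) (nu1 Q)"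
  shows "factors_through C k (lft Q)"
proof -
  obtain y where y: "y \<in> hom C K (Q1 Q)" "cocomp Q \<cdot> k = nu1 Q \<cdot> y"
    using factors_throughE[OF y cmp_in_hom[OF k cocomp_hom]] in_homD[OF nu_hom(1)] by metis
  have "k = y"
    using counit_cmp(2)[OF k] cmp_assoc[OF y(1) nu_hom(1) copair_rgt(1)] copair_rgt(2)
      cmp_idn_left[OF y(1)] y(2) by simp
  moreover have "k = lft Q \<cdot> cid Q \<cdot> y"
    using counit_cmp(1)[OF k] cmp_assoc[OF y(1) nu_hom(1) copair_lft(1)] copair_lft(2)
      cmp_assoc[OF y(1) cid_hom lft_hom] y(2) by simp
  ultimately show ?thesis
    using factors_throughI[OF cmp_in_hom[OF y(1) cid_hom] lft_hom] by simp
qed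

text \<open>The mirror image: now \<open>[l i, 1]\<close> gives \<open>k = y\<close>, and
  \<open>[1, r i]\<close> gives \<open>k = r i y\<close>.\<close>

lemma factors_nu2_imp_rgt:
  assumes k: "k \<in> hom C K (Q1 Q)" and y: "factors_through C (cocomp Q \<cdot> k) (nu2 Q)"
  shows "factors_through C k (rgt Q)"
proof -
  obtain y where y: "y \<in> hom C K (Q1 Q)" "cocomp Q \<cdot> k = nu2 Q \<cdot> y"
    using factors_throughE[OF y cmp_in_hom[OF k cocomp_hom]] in_homD[OF nu_hom(2)] by metis
  have "k = y"
    using counit_cmp(1)[OF k] cmp_assoc[OF y(1) nu_hom(2) copair_lft(1)] copair_lft(3)
      cmp_idn_left[OF y(1)] y(2) by simp
  moreover have "k = rgt Q \<cdot> cid Q \<cdot> y"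
    using counit_cmp(2)[OF k] cmp_assoc[OF y(1) nu_hom(2) copair_rgt(1)] copair_rgt(3)
      cmp_assoc[OF y(1) cid_hom rgt_hom] y(2) by simp
  ultimately show ?thesis
    using factors_throughI[OF cmp_in_hom[OF y(1) cid_hom] rgt_hom] by simp
qed

end

section \<open>Covering by the endpoints and the co-inverse\<close>

locale coherent_co_category = coherent_category C + co_category C Q
  for C :: "('o, 'a) cat" (structure) and Q :: "('o, 'a) cocat"
begin

text \<open>This expresses that \<open>l\<close> and \<open>r\<close> cover \<open>Q1 Q\<close>
  without forming their union there: the case distinction is made on \<open>q\<close>, along the
  union of the two coprojections.\<close>

lemma endpoints_cover:
  assumes n: "n \<in> subobj C (Q1 Q)"
    and "factors_through C (lft Q) n" "factors_through C (rgt Q) n"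
  obtains h where "h \<in> hom C (Q1 Q) (Dom C n)" "n \<cdot> h = Idn C (Q1 Q)"
proof -
  obtain u where u: "is_union C (Q2 Q) {nu1 Q, nu2 Q} u"
    using unions[OF Q2_obj _ nu_subobj] by auto
  have trans: "factors_through C k n"
    if k: "k \<in> hom C K (Q1 Q)" and ke: "factors_through C k e" and e: "e \<in> hom C (Q0 Q) (Q1 Q)"
      "factors_through C e n" for K k e
  proof -
    obtain a where a: "a \<in> hom C K (Q0 Q)" "k = e \<cdot> a"
      using factors_throughE[OF ke k] in_homD[OF e(1)] by metis
    obtain b where b: "b \<in> hom C (Q0 Q) (Dom C n)" "e = n \<cdot> b"
      using factors_throughE[OF e(2,1)] by metis
    show ?thesis
      using factors_throughI[OF cmp_in_hom[OF a(1) b(1)] subobj_hom[OF n]]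
        cmp_assoc[OF a(1) b(1) subobj_hom[OF n]] a(2) b(2) by simp
  qed
  have "factors_through C k n"
    if k: "k \<in> hom C K (Q1 Q)" and m: "m \<in> {nu1 Q, nu2 Q}" "factors_through C (cocomp Q \<cdot> k) m"
    for K k m
    using m trans[OF k factors_nu1_imp_lft[OF k] lft_hom] trans[OF k factors_nu2_imp_rgt[OF k] rgt_hom]
      assms(2,3) by auto
  then show thesis
    using union_cases_subobj[OF _ nu_subobj u cocomp_hom nu_union[OF u] n] that by blast
qed

text \<open>The equalizer of \<open>f\<close> and \<open>g\<close> contains both endpoints, so it is
  all of \<open>Q1 Q\<close>.\<close>

lemma endpoints_jointly_epi:
  assumes fg: "f \<in> hom C (Q1 Q) Z" "g \<in> hom C (Q1 Q) Z"
    and eq: "f \<cdot> lft Q = g \<cdot> lft Q" "f \<cdot> rgt Q = g \<cdot> rgt Q"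
  shows "f = g"
proof -
  obtain e where e: "e \<in> subobj C (Q1 Q)" "f \<cdot> e = g \<cdot> e"
    "\<And>K k. k \<in> hom C K (Q1 Q) \<Longrightarrow> f \<cdot> k = g \<cdot> k \<Longrightarrow> factors_through C k e"
    using exists_equalizer[OF finite_limits fg] by metis
  obtain h where h: "h \<in> hom C (Q1 Q) (Dom C e)" "e \<cdot> h = Idn C (Q1 Q)"
    by (rule endpoints_cover[OF e(1) e(3)[OF lft_hom eq(1)] e(3)[OF rgt_hom eq(2)]])
  show ?thesis
    by (rule split_epi_cancel[OF subobj_hom[OF e(1)] h fg e(2)])
qed

text \<open>Let \<open>u\<close>, with domain \<open>R\<close>, be the union of
  \<open>(l, r)\<close> and \<open>(r, l)\<close> in the product. Its first projection
  \<open>p1 \<cdot> u\<close> is monic since the relation is single-valued, and it contains both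
  endpoints, so it has a section \<open>h\<close>. The map sought is the second projection after
  \<open>h\<close>.\<close>

lemma exists_swap:
  obtains s where "s \<in> hom C (Q1 Q) (Q1 Q)" "s \<cdot> lft Q = rgt Q" "s \<cdot> rgt Q = lft Q"
proof -
  obtain P p1 p2 where P: "P \<in> Obj C" and p1: "p1 \<in> hom C P (Q1 Q)" and p2: "p2 \<in> hom C P (Q1 Q)"
    and prod: "\<forall>Y. \<forall>a \<in> hom C Y (Q1 Q). \<forall>b \<in> hom C Y (Q1 Q).
      \<exists>!h. h \<in> hom C Y P \<and> p1 \<cdot> h = a \<and> p2 \<cdot> h = b"
    by (rule exists_product[OF finite_limits Q1_obj Q1_obj])
  note univ = prod[rule_format]
  have p_eq: "a = b"
    if "a \<in> hom C Y P" "b \<in> hom C Y P" "p1 \<cdot> a = p1 \<cdot> b" "p2 \<cdot> a = p2 \<cdot> b" for Y a b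
    using univ[OF cmp_in_hom[OF that(1) p1] cmp_in_hom[OF that(1) p2]] that by metis
  obtain m1 where m1: "m1 \<in> hom C (Q0 Q) P" "p1 \<cdot> m1 = lft Q" "p2 \<cdot> m1 = rgt Q"
    using univ[OF lft_hom rgt_hom] by blast
  obtain m2 where m2: "m2 \<in> hom C (Q0 Q) P" "p1 \<cdot> m2 = rgt Q" "p2 \<cdot> m2 = lft Q"
    using univ[OF rgt_hom lft_hom] by blast
  have p1m: "p1 \<cdot> m1 \<cdot> a = lft Q \<cdot> a" "p2 \<cdot> m1 \<cdot> a = rgt Q \<cdot> a"
    "p1 \<cdot> m2 \<cdot> a = rgt Q \<cdot> a" "p2 \<cdot> m2 \<cdot> a = lft Q \<cdot> a" if "a \<in> hom C Y (Q0 Q)" for Y a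
    using cmp_assoc[OF that m1(1) p1] cmp_assoc[OF that m1(1) p2] cmp_assoc[OF that m2(1) p1]
      cmp_assoc[OF that m2(1) p2] m1 m2 by auto
  \<comment> \<open>Both pairs are split by \<open>i p1\<close>, as \<open>i l\<close> and
    \<open>i r\<close> are identities.\<close>
  have "m1 \<in> subobj C P" "m2 \<in> subobj C P"
    using split_mono_subobj[OF m1(1) cmp_in_hom[OF p1 cid_hom]]
      split_mono_subobj[OF m2(1) cmp_in_hom[OF p1 cid_hom]]
      cmp_assoc[OF m1(1) p1 cid_hom] cmp_assoc[OF m2(1) p1 cid_hom] m1(2) m2(2) cid_lft cid_rgt
    by auto
  then have S: "finite {m1, m2}" "{m1, m2} \<subseteq> subobj C P"
    by auto
  obtain u where u: "is_union C P {m1, m2} u"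
    using unions[OF P S] by auto
  define R where "R = Dom C u"
  have su: "u \<in> subobj C P" and uh: "u \<in> hom C R P"
    using u subobj_hom by (auto simp: is_union_def R_def)
  have "factors_through C m1 u" "factors_through C m2 u"
    using u by (auto simp: is_union_def)
  then obtain a1 a2 where a1: "a1 \<in> hom C (Q0 Q) R" "m1 = u \<cdot> a1"
    and a2: "a2 \<in> hom C (Q0 Q) R" "m2 = u \<cdot> a2"
    using factors_throughE m1(1) m2(1) unfolding R_def by metis
  have on_graph: "\<exists>c \<in> hom C K (Q0 Q).
      p1 \<cdot> v = lft Q \<cdot> c \<and> p2 \<cdot> v = rgt Q \<cdot> c \<or> p1 \<cdot> v = rgt Q \<cdot> c \<and> p2 \<cdot> v = lft Q \<cdot> c"
    if v: "v \<in> hom C K P" "m \<in> {m1, m2}" "factors_through C v m" for K v m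
  proof -
    have "Dom C m = Q0 Q"
      using v(2) in_homD[OF m1(1)] in_homD[OF m2(1)] by auto
    then obtain c where "c \<in> hom C K (Q0 Q)" "v = m \<cdot> c"
      using factors_throughE[OF v(3,1)] by metis
    then show ?thesis
      using v(2) p1m by auto
  qed
  have functional: "p2 \<cdot> v = p2 \<cdot> v'"
    if v: "v \<in> hom C K P" "m \<in> {m1, m2}" "factors_through C v m"
      and v': "v' \<in> hom C K P" "m' \<in> {m1, m2}" "factors_through C v' m'"
      and eq: "p1 \<cdot> v = p1 \<cdot> v'" for K v v' m m'
  proof -
    obtain c where c: "c \<in> hom C K (Q0 Q)"
      "p1 \<cdot> v = lft Q \<cdot> c \<and> p2 \<cdot> v = rgt Q \<cdot> c \<or> p1 \<cdot> v = rgt Q \<cdot> c \<and> p2 \<cdot> v = lft Q \<cdot> c"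
      using on_graph[OF v] by blast
    obtain c' where c': "c' \<in> hom C K (Q0 Q)"
      "p1 \<cdot> v' = lft Q \<cdot> c' \<and> p2 \<cdot> v' = rgt Q \<cdot> c' \<or> p1 \<cdot> v' = rgt Q \<cdot> c' \<and> p2 \<cdot> v' = lft Q \<cdot> c'"
      using on_graph[OF v'] by blast
    \<comment> \<open>The parameter is recovered from the first component whichever of
      \<open>l\<close> and \<open>r\<close> occurs there. In the mixed case the equation becomes
      \<open>l c = r c\<close> up to symmetry, and the second components are these same two
      arrows.\<close>
    have "c = cid Q \<cdot> p1 \<cdot> v" "c' = cid Q \<cdot> p1 \<cdot> v'"
      using c(2) c'(2) cid_lft_cmp[OF c(1)] cid_rgt_cmp[OF c(1)] cid_lft_cmp[OF c'(1)]
        cid_rgt_cmp[OF c'(1)] by auto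
    then have "c = c'"
      using eq by simp
    then show ?thesis
      using c(2) c'(2) eq by auto
  qed
  \<comment> \<open>Both \<open>u \<cdot> f\<close> and \<open>u \<cdot> g\<close> must be resolved
    into one of the two pairs, so two case distinctions are nested: one restricts along
    \<open>k\<close>, the other further along \<open>j\<close>.\<close>
  have mono: "f = g" if f: "f \<in> hom C Y R" and g: "g \<in> hom C Y R"
    and fg: "(p1 \<cdot> u) \<cdot> f = (p1 \<cdot> u) \<cdot> g" for Y f g
  proof (rule union_cases_eq[OF S u cmp_in_hom[OF f uh] factors_throughI[OF f uh refl] f g])
    fix K k m
    assume k: "k \<in> hom C K Y" and m: "m \<in> {m1, m2}" "factors_through C ((u \<cdot> f) \<cdot> k) m"
    have uf: "u \<cdot> f \<in> hom C Y P" and ug: "u \<cdot> g \<in> hom C Y P"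
      and fk: "f \<cdot> k \<in> hom C K R" and gk: "g \<cdot> k \<in> hom C K R"
      using cmp_in_hom f g k uh by blast+
    show "f \<cdot> k = g \<cdot> k"
    proof (rule union_cases_eq[OF S u cmp_in_hom[OF gk uh] factors_throughI[OF gk uh refl] fk gk])
      fix L j m'
      assume j: "j \<in> hom C L K" and m': "m' \<in> {m1, m2}" "factors_through C ((u \<cdot> g \<cdot> k) \<cdot> j) m'"
      have ufk: "u \<cdot> f \<cdot> k \<in> hom C K P" and ugk: "u \<cdot> g \<cdot> k \<in> hom C K P"
        and fkj: "(f \<cdot> k) \<cdot> j \<in> hom C L R" and gkj: "(g \<cdot> k) \<cdot> j \<in> hom C L R"
        using cmp_in_hom fk gk uh j by blast+
      let ?v = "(u \<cdot> f \<cdot> k) \<cdot> j" and ?v' = "(u \<cdot> g \<cdot> k) \<cdot> j"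
      have v: "?v \<in> hom C L P" and v': "?v' \<in> hom C L P"
        using cmp_in_hom j ufk ugk by blast+
      have mP: "m \<in> hom C (Dom C m) P"
        using m(1) S(2) subobj_hom by blast
      \<comment> \<open>The case already chosen for \<open>u \<cdot> f\<close> on \<open>K\<close>
        persists after restriction along \<open>j\<close>.\<close>
      obtain c where c: "c \<in> hom C K (Dom C m)" "u \<cdot> f \<cdot> k = m \<cdot> c"
        using factors_throughE[OF m(2) cmp_in_hom[OF k uf]] cmp_assoc[OF k f uh] by metis
      have vm: "factors_through C ?v m"
        using factors_throughI[OF cmp_in_hom[OF j c(1)] mP] cmp_assoc[OF j c(1) mP] c(2) by simp
      have p1uf: "p1 \<cdot> (u \<cdot> f \<cdot> k) = p1 \<cdot> (u \<cdot> g \<cdot> k)"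
        using cmp_assoc[OF k f uh] cmp_assoc[OF k g uh] cmp_assoc[OF k uf p1] cmp_assoc[OF k ug p1]
          cmp_assoc[OF f uh p1] cmp_assoc[OF g uh p1] fg by simp
      have eq: "p1 \<cdot> ?v = p1 \<cdot> ?v'"
        using cmp_assoc[OF j ufk p1] cmp_assoc[OF j ugk p1] p1uf by simp
      have "?v = ?v'"
        using p_eq[OF v v' eq functional[OF v m(1) vm v' m' eq]] .
      then show "(f \<cdot> k) \<cdot> j = (g \<cdot> k) \<cdot> j"
        using subobj_cancel[OF su fkj[unfolded R_def] gkj[unfolded R_def]]
          cmp_assoc[OF j fk uh] cmp_assoc[OF j gk uh] by simp
    qed
  qed
  have n: "p1 \<cdot> u \<in> hom C R (Q1 Q)"
    using cmp_in_hom[OF uh p1] .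
  have sub: "p1 \<cdot> u \<in> subobj C (Q1 Q)"
    using mono in_homD[OF n] by (auto simp: subobj_def monic_def)
  have la: "lft Q = (p1 \<cdot> u) \<cdot> a1" and ra: "rgt Q = (p1 \<cdot> u) \<cdot> a2"
    using cmp_assoc[OF a1(1) uh p1] cmp_assoc[OF a2(1) uh p1] m1 m2 a1 a2 by auto
  obtain h where "h \<in> hom C (Q1 Q) (Dom C (p1 \<cdot> u))" and hn: "(p1 \<cdot> u) \<cdot> h = Idn C (Q1 Q)"
    using endpoints_cover[OF sub factors_throughI[OF a1(1) n la] factors_throughI[OF a2(1) n ra]]
    by metis
  then have h: "h \<in> hom C (Q1 Q) R"
    using in_homD[OF n] by simp
  \<comment> \<open>Both sides are lifts of \<open>l\<close> through the monic
    \<open>p1 \<cdot> u\<close>; likewise for \<open>r\<close> below.\<close>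
  have "h \<cdot> lft Q = a1"
    using mono[OF cmp_in_hom[OF lft_hom h] a1(1)] cmp_assoc[OF lft_hom h n] hn
      cmp_idn_left[OF lft_hom] la by simp
  moreover have "h \<cdot> rgt Q = a2"
    using mono[OF cmp_in_hom[OF rgt_hom h] a2(1)] cmp_assoc[OF rgt_hom h n] hn
      cmp_idn_left[OF rgt_hom] ra by simp
  moreover have p2u: "p2 \<cdot> u \<in> hom C R (Q1 Q)"
    using cmp_in_hom[OF uh p2] .
  moreover have "(p2 \<cdot> u) \<cdot> a1 = rgt Q" "(p2 \<cdot> u) \<cdot> a2 = lft Q"
    using cmp_assoc[OF a1(1) uh p2] cmp_assoc[OF a2(1) uh p2] m1 m2 a1 a2 by auto
  \<comment> \<open>The witness is \<open>(p2 \<cdot> u) \<cdot> h\<close>; it sends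
    \<open>l\<close> to the second component of \<open>m1\<close>, which is \<open>r\<close>, and
    \<open>r\<close> to that of \<open>m2\<close>, which is \<open>l\<close>.\<close>
  ultimately show thesis
    using that[OF cmp_in_hom[OF h p2u]] cmp_assoc[OF lft_hom h p2u] cmp_assoc[OF rgt_hom h p2u]
    by simp
qed

text \<open>Since \<open>q l = nu1 l\<close> and \<open>q r = nu2 r\<close>, the composite
  \<open>[a, b] q\<close> restricts to \<open>a l\<close> and \<open>b r\<close> at the endpoints,
  and the endpoints are jointly epimorphic.\<close>

lemma copair_cocomp_eqI:
  assumes a: "a \<in> hom C (Q1 Q) Z" and b: "b \<in> hom C (Q1 Q) Z" and ab: "a \<cdot> rgt Q = b \<cdot> lft Q"
    and f: "f \<in> hom C (Q1 Q) Z" and "f \<cdot> lft Q = a \<cdot> lft Q" "f \<cdot> rgt Q = b \<cdot> rgt Q"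
  shows "copair C Q a b \<cdot> cocomp Q = f"
proof (rule endpoints_jointly_epi)
  note cp = copair[OF a b ab]
  show "copair C Q a b \<cdot> cocomp Q \<in> hom C (Q1 Q) Z"
    using cmp_in_hom[OF cocomp_hom cp(1)] .
  show "(copair C Q a b \<cdot> cocomp Q) \<cdot> lft Q = f \<cdot> lft Q"
    using cmp_assoc[OF lft_hom cocomp_hom cp(1)] cmp_assoc[OF lft_hom nu_hom(1) cp(1)]
      cocomp_lft cp(2) assms(5) by simp
  show "(copair C Q a b \<cdot> cocomp Q) \<cdot> rgt Q = f \<cdot> rgt Q"
    using cmp_assoc[OF rgt_hom cocomp_hom cp(1)] cmp_assoc[OF rgt_hom nu_hom(2) cp(1)]
      cocomp_rgt cp(3) assms(6) by simp
qed fact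

lemma co_equivalence_relation: "co_equivalence_relation C Q"
proof unfold_locales
  obtain s where s: "s \<in> hom C (Q1 Q) (Q1 Q)" "s \<cdot> lft Q = rgt Q" "s \<cdot> rgt Q = lft Q"
    by (rule exists_swap)
  have ends: "Idn C (Q1 Q) \<cdot> lft Q = lft Q" "Idn C (Q1 Q) \<cdot> rgt Q = rgt Q"
    "(lft Q \<cdot> cid Q) \<cdot> lft Q = lft Q" "(lft Q \<cdot> cid Q) \<cdot> rgt Q = lft Q"
    "(rgt Q \<cdot> cid Q) \<cdot> lft Q = rgt Q" "(rgt Q \<cdot> cid Q) \<cdot> rgt Q = rgt Q"
    using cmp_idn_left[OF lft_hom] cmp_idn_left[OF rgt_hom] degenerate_glue
      cmp_assoc[OF lft_hom cid_hom lft_hom] cmp_assoc[OF rgt_hom cid_hom rgt_hom]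
      cmp_idn_right[OF lft_hom] cmp_idn_right[OF rgt_hom]
    by (simp_all add: cid_lft cid_rgt)
  show "\<exists>s \<in> hom C (Q1 Q) (Q1 Q). s \<cdot> lft Q = rgt Q \<and> s \<cdot> rgt Q = lft Q \<and>
      copair C Q (Idn C (Q1 Q)) s \<cdot> cocomp Q = lft Q \<cdot> cid Q \<and>
      copair C Q s (Idn C (Q1 Q)) \<cdot> cocomp Q = rgt Q \<cdot> cid Q"
  \<comment> \<open>At both endpoints \<open>[1, s] q\<close> and \<open>l i\<close> give
    \<open>l\<close>, while \<open>[s, 1] q\<close> and \<open>r i\<close> give
    \<open>r\<close>.\<close>
  proof (intro bexI[OF _ s(1)] conjI s(2,3))
    show "copair C Q (Idn C (Q1 Q)) s \<cdot> cocomp Q = lft Q \<cdot> cid Q"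
      by (rule copair_cocomp_eqI[OF idn_Q1 s(1) _ degenerate_glue(1)]) (simp_all add: ends s)
    show "copair C Q s (Idn C (Q1 Q)) \<cdot> cocomp Q = rgt Q \<cdot> cid Q"
      by (rule copair_cocomp_eqI[OF s(1) idn_Q1 _ degenerate_glue(2)]) (simp_all add: ends s)
  qed
qed (rule endpoints_jointly_epi)

end

theorem proposition1:
  fixes C :: "('o, 'a) cat" and Q :: "('o, 'a) cocat"
  assumes "coherent_category C"
    and "co_category C Q"
  shows "co_equivalence_relation C Q"
proof -
  interpret coherent_co_category C Q
    using assms by (simp add: coherent_co_category_def)
  show ?thesis
    by (rule co_equivalence_relation)
qed

end
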